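(* (Generalized Jacobi identities.) Let $s\in\mathbb N$ and let $\mathcal H=\{X_1,\dots,X_m\}$ be a family of vector fields on $\mathbb R^n$ in the regularity class $C^{s-1,1}_{\mathcal H,\mathrm{loc}}\cap C^1$. For any words $v$ of length $p$ and $w$ of length $q$ with $p,q\ge1$ and $p+q\le s$, $$X_{[v]w}=\sum_{\sigma\in\mathfrak S_p}\pi_p(\sigma)\,X_{\sigma_1(v)\cdots\sigma_p(v)w}.$$ If $|w|=0$ (that is, $w$ is the empty word), then this identity fails, but for any word $v=v_1\cdots v_\ell$ of length $\ell\le s$ we have $$X_v=\frac1\ell\sum_{\sigma\in\mathfrak S_\ell}\pi_\ell(\sigma)\,X_{\sigma_1(v)\cdots\sigma_\ell(v)}.$$
   Context: Write $X_j=f_j\cdot\nabla$ with $f_j:\mathbb R^n\to\mathbb R^n$; $e^{tX}x$ is the (local) flow of a $C^1$ vector field. Lie derivative: $X^\sharp g(x):=\lim_{t\to0}\frac1t(g(e^{tX}x)-g(x))$ (componentwise for vector valued $g$). Regularity class: let $d(x,y):=\inf\{r>0:\ y=e^{t_1Z_1}\cdots e^{t_\mu Z_\mu}x$ for some $\mu\in\mathbb N$, $\sum_j|t_j|\le1$, $Z_j\in\{rX_1,\dots,rX_m\}\}$ ($=+\infty$ if there are none). $g$ is $d$-Lipschitz on $A$ if $\sup_{x\neq y\in A}|g(x)-g(y)|/d(x,y)<\infty$. $g\in C^{k,1}_{\mathcal H,\mathrm{loc}}$ means that all derivatives $X_{j_1}^\sharp\cdots X_{j_k}^\sharp g$ exist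 and are $d$-Lipschitz on each Euclidean-bounded set. A vector field is in a class if its coefficients are. $C^1$ is Euclidean $C^1$. Commutators: a word $w=w_1\cdots w_\ell$ has letters in $\{1,\dots,m\}$ and length $|w|=\ell$; juxtaposition is concatenation. For $\sigma\in\mathfrak S_\ell$ put $\sigma_i(w):=w_{\sigma(i)}$. Define $\pi_\ell:\mathfrak S_\ell\to\{-1,0,1\}$ by $\pi_1=1$ and, for $\tau\in\mathfrak S_{\ell+1}$: if $\tau(1)=1$ then $\pi_{\ell+1}(\tau)=\pi_\ell(\sigma)$ with $\sigma(i)=\tau(i+1)-1$; if $\tau(\ell+1)=1$ then $\pi_{\ell+1}(\tau)=-\pi_\ell(\sigma)$ with $\sigma(i)=\tau(i)-1$; otherwise $\pi_{\ell+1}(\tau)=0$. For $|w|=\ell\le s$, $f_w:=\sum_{\sigma\in\mathfrak S_\ell}\pi_\ell(\sigma)X^\sharp_{\sigma_1(w)}\cdots X^\sharp_{\sigma_{\ell-1}(w)}f_{\sigma_\ell(w)}$ and $X_w:=f_w\cdot\nabla$. For $|w|=\ell\le s-1$, $X_w^\sharp:=\sum_{\sigma\in\mathfrak S_\ell}\pi_\ell(\sigma)X^\sharp_{\sigma_1(w)}\cdots X^\sharp_{\sigma_\ell(w)}$. For words $u,v$ with $|u|+|v|\le s$, $X_{[u]v}:=[X_u,X_v]:=(X_u^\sharp f_v-X_v^\sharp f_u)\cdot\nabla$. Equalities between operators $g\cdot\nabla$ mean equality of the coefficients $g$. When $w$ is the empty word, $X_{[v]w}$ and $X_{vw}$ are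 read as $X_v$, so the first identity would read $X_v=\sum_{\sigma\in\mathfrak S_p}\pi_p(\sigma)X_{\sigma_1(v)\cdots\sigma_p(v)}$; that it "fails" means that it is not valid as a general identity. *)

theory Defs
  imports "HOL-Analysis.Analysis" "HOL-Combinatorics.Permutations"
begin

text \<open>
  A vector field \<open>Z = g \<cdot> \<nabla>\<close> on \<open>\<real>\<^sup>n\<close> is represented by its coefficient function
  \<open>g :: real^'n \<Rightarrow> real^'n\<close>, so that equality of vector fields is equality of functions.
  A family \<open>X\<^sub>1, \<dots>, X\<^sub>m\<close> is given by \<open>f :: nat \<Rightarrow> real^'n \<Rightarrow> real^'n\<close>,
  of which only the values at indices in \<open>{1..m}\<close> are relevant.
\<close>

subsection \<open>Flows and Lie derivatives\<close>

text \<open>\<open>is_flow Z t x y\<close>: the flow value \<open>e\<^bsup>tZ\<^esup>x\<close> is defined and equals \<open>y\<close>.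
  The sign of \<open>t\<close> is arbitrary.\<close>

definition is_flow :: "(real^'n \<Rightarrow> real^'n) \<Rightarrow> real \<Rightarrow> real^'n \<Rightarrow> real^'n \<Rightarrow> bool" where
  "is_flow Z t x y \<longleftrightarrow> (\<exists>u. u 0 = x \<and> u t = y \<and>
     (\<forall>\<tau>\<in>closed_segment 0 t. (u has_vector_derivative Z (u \<tau>)) (at \<tau> within closed_segment 0 t)))"

text \<open>For a \<open>C\<^sup>1\<close> field the value is unique, and it exists for all \<open>t\<close> close to \<open>0\<close>
  (depending on \<open>x\<close>), which is all that matters in the limits below.\<close>

definition flow :: "(real^'n \<Rightarrow> real^'n) \<Rightarrow> real \<Rightarrow> real^'n \<Rightarrow> real^'n" where
  "flow Z t x = (THE y. is_flow Z t x y)"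

definition lie_quotient ::
    "(real^'n \<Rightarrow> real^'n) \<Rightarrow> (real^'n \<Rightarrow> 'b::real_normed_vector) \<Rightarrow> real^'n \<Rightarrow> real \<Rightarrow> 'b" where
  "lie_quotient Z g x t = (1 / t) *\<^sub>R (g (flow Z t x) - g x)"

definition lie_differentiable ::
    "(real^'n \<Rightarrow> real^'n) \<Rightarrow> (real^'n \<Rightarrow> 'b::real_normed_vector) \<Rightarrow> bool" where
  "lie_differentiable Z g \<longleftrightarrow> (\<forall>x. \<exists>l. (lie_quotient Z g x \<longlongrightarrow> l) (at 0))"

definition lie_deriv ::
    "(real^'n \<Rightarrow> real^'n) \<Rightarrow> (real^'n \<Rightarrow> 'b::real_normed_vector) \<Rightarrow> real^'n \<Rightarrow> 'b" where
  "lie_deriv Z g x = Lim (at 0) (lie_quotient Z g x)"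

text \<open>\<open>iter_lie f [j\<^sub>1, \<dots>, j\<^sub>k] g\<close> is \<open>X\<^sub>j\<^sub>1\<^sup>\<sharp> \<cdots> X\<^sub>j\<^sub>k\<^sup>\<sharp> g\<close>
  (the last field acts first); \<open>iter_lie_exists\<close> says that all limits involved exist.\<close>

primrec iter_lie :: "(nat \<Rightarrow> real^'n \<Rightarrow> real^'n) \<Rightarrow> nat list \<Rightarrow>
    (real^'n \<Rightarrow> 'b::real_normed_vector) \<Rightarrow> real^'n \<Rightarrow> 'b" where
  "iter_lie f [] g = g"
| "iter_lie f (j # js) g = lie_deriv (f j) (iter_lie f js g)"

primrec iter_lie_exists :: "(nat \<Rightarrow> real^'n \<Rightarrow> real^'n) \<Rightarrow> nat list \<Rightarrow>
    (real^'n \<Rightarrow> 'b::real_normed_vector) \<Rightarrow> bool" where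
  "iter_lie_exists f [] g \<longleftrightarrow> True"
| "iter_lie_exists f (j # js) g \<longleftrightarrow>
     iter_lie_exists f js g \<and> lie_differentiable (f j) (iter_lie f js g)"

subsection \<open>The distance and the regularity class\<close>

text \<open>\<open>flow_comp [(t\<^sub>1, Z\<^sub>1), \<dots>, (t\<^sub>\<mu>, Z\<^sub>\<mu>)] x y\<close>: the composition
  \<open>e\<^bsup>t\<^sub>1Z\<^sub>1\<^esup> \<cdots> e\<^bsup>t\<^sub>\<mu>Z\<^sub>\<mu>\<^esup>x\<close> is defined and equals \<open>y\<close>.\<close>

primrec flow_comp :: "(real \<times> (real^'n \<Rightarrow> real^'n)) list \<Rightarrow> real^'n \<Rightarrow> real^'n \<Rightarrow> bool" where
  "flow_comp [] x y \<longleftrightarrow> y = x"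
| "flow_comp (p # ps) x y \<longleftrightarrow> (\<exists>z. flow_comp ps x z \<and> is_flow (snd p) (fst p) z y)"

text \<open>The value is \<open>\<infinity>\<close> (the infimum of the empty set) if \<open>y\<close> cannot be reached from \<open>x\<close>.\<close>

definition ctrl_dist ::
    "nat \<Rightarrow> (nat \<Rightarrow> real^'n \<Rightarrow> real^'n) \<Rightarrow> real^'n \<Rightarrow> real^'n \<Rightarrow> ennreal" where
  "ctrl_dist m f x y = Inf {ennreal r | r. r > 0 \<and>
     (\<exists>ps. (\<Sum>(t, Z)\<leftarrow>ps. \<bar>t\<bar>) \<le> 1 \<and>
           (\<forall>(t, Z)\<in>set ps. Z \<in> {\<lambda>z. r *\<^sub>R f j z | j. j \<in> {1..m}}) \<and>
           flow_comp ps x y)}"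

text \<open>In \<open>ennreal\<close>, \<open>a / \<infinity> = 0\<close> for finite \<open>a\<close>, while \<open>a / 0 = \<infinity>\<close> for \<open>a \<noteq> 0\<close>.\<close>

definition ctrl_lipschitz_on :: "nat \<Rightarrow> (nat \<Rightarrow> real^'n \<Rightarrow> real^'n) \<Rightarrow>
    (real^'n) set \<Rightarrow> (real^'n \<Rightarrow> 'b::real_normed_vector) \<Rightarrow> bool" where
  "ctrl_lipschitz_on m f A g \<longleftrightarrow>
     (SUP (x, y)\<in>{(x, y). x \<in> A \<and> y \<in> A \<and> x \<noteq> y}.
        ennreal (norm (g x - g y)) / ctrl_dist m f x y) < \<infinity>"

text \<open>The class \<open>C\<^bsup>k,1\<^esup>\<close> with respect to \<open>f 1, \<dots>, f m\<close>, locally.\<close>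

definition horiz_class :: "nat \<Rightarrow> (nat \<Rightarrow> real^'n \<Rightarrow> real^'n) \<Rightarrow> nat \<Rightarrow>
    (real^'n \<Rightarrow> 'b::real_normed_vector) \<Rightarrow> bool" where
  "horiz_class m f k g \<longleftrightarrow>
     (\<forall>js\<in>lists {1..m}. length js = k \<longrightarrow>
        iter_lie_exists f js g \<and>
        (\<forall>A. bounded A \<longrightarrow> ctrl_lipschitz_on m f A (iter_lie f js g)))"

definition C1 :: "('a::real_normed_vector \<Rightarrow> 'b::real_normed_vector) \<Rightarrow> bool" where
  "C1 g \<longleftrightarrow> (\<exists>g' :: 'a \<Rightarrow> 'a \<Rightarrow>\<^sub>L 'b.
     (\<forall>x. (g has_derivative blinfun_apply (g' x)) (at x)) \<and> continuous_on UNIV g')"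

definition regular_family :: "nat \<Rightarrow> nat \<Rightarrow> (nat \<Rightarrow> real^'n \<Rightarrow> real^'n) \<Rightarrow> bool" where
  "regular_family s m f \<longleftrightarrow> (\<forall>j\<in>{1..m}. horiz_class m f (s - 1) (f j) \<and> C1 (f j))"

subsection \<open>Commutators\<close>

text \<open>
  Words are lists of letters.  Positions are counted from \<open>0\<close>, so \<open>\<SS>\<^sub>\<ell>\<close> is
  \<open>{\<sigma>. \<sigma> permutes {..<\<ell>}}\<close> and the word \<open>\<sigma>\<^sub>1(w) \<cdots> \<sigma>\<^sub>\<ell>(w)\<close> is \<open>permute_list \<sigma> w\<close>.
  The coefficient \<open>\<pi>\<^sub>\<ell>(\<sigma>)\<close> below depends only on the restriction of \<open>\<sigma>\<close> to \<open>{..<\<ell>}\<close>,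
  hence the functions in the recursive calls need not be adjusted outside that range.
  The value for \<open>\<ell> = 0\<close> is a dummy.
\<close>

fun perm_coeff :: "nat \<Rightarrow> (nat \<Rightarrow> nat) \<Rightarrow> int" where
  "perm_coeff 0 \<sigma> = 0"
| "perm_coeff (Suc 0) \<sigma> = 1"
| "perm_coeff (Suc (Suc k)) \<tau> =
     (if \<tau> 0 = 0 then perm_coeff (Suc k) (\<lambda>i. \<tau> (Suc i) - 1)
      else if \<tau> (Suc k) = 0 then - perm_coeff (Suc k) (\<lambda>i. \<tau> i - 1)
      else 0)"

text \<open>\<open>comm_field f w\<close> is \<open>f\<^sub>w\<close>, i.e. the vector field \<open>X\<^sub>w\<close>, for nonempty \<open>w\<close>.\<close>

definition comm_field :: "(nat \<Rightarrow> real^'n \<Rightarrow> real^'n) \<Rightarrow> nat list \<Rightarrow> real^'n \<Rightarrow> real^'n" where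
  "comm_field f w = (\<lambda>x. \<Sum>\<sigma> | \<sigma> permutes {..<length w}.
     of_int (perm_coeff (length w) \<sigma>) *\<^sub>R
       iter_lie f (butlast (permute_list \<sigma> w)) (f (last (permute_list \<sigma> w))) x)"

text \<open>\<open>comm_deriv f w g\<close> is \<open>X\<^sub>w\<^sup>\<sharp> g\<close>; this is not by definition the Lie derivative
  along the field \<open>X\<^sub>w\<close>.\<close>

definition comm_deriv :: "(nat \<Rightarrow> real^'n \<Rightarrow> real^'n) \<Rightarrow> nat list \<Rightarrow>
    (real^'n \<Rightarrow> 'b::real_normed_vector) \<Rightarrow> real^'n \<Rightarrow> 'b" where
  "comm_deriv f w g = (\<lambda>x. \<Sum>\<sigma> | \<sigma> permutes {..<length w}.
     of_int (perm_coeff (length w) \<sigma>) *\<^sub>R iter_lie f (permute_list \<sigma> w) g x)"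

text \<open>\<open>bracket_field f u v\<close> is \<open>X\<^bsub>[u]v\<^esub> = [X\<^sub>u, X\<^sub>v]\<close>.\<close>

definition bracket_field ::
    "(nat \<Rightarrow> real^'n \<Rightarrow> real^'n) \<Rightarrow> nat list \<Rightarrow> nat list \<Rightarrow> real^'n \<Rightarrow> real^'n" where
  "bracket_field f u v =
     (\<lambda>x. comm_deriv f u (comm_field f v) x - comm_deriv f v (comm_field f u) x)"

text \<open>The field \<open>\<Sum>\<^bsub>\<sigma>\<^esub> \<pi>\<^sub>p(\<sigma>) X\<^bsub>\<sigma>\<^sub>1(v)\<cdots>\<sigma>\<^sub>p(v)w\<^esub>\<close>, \<open>p = |v|\<close>; here \<open>w\<close> may be empty.\<close>

definition jacobi_sum ::
    "(nat \<Rightarrow> real^'n \<Rightarrow> real^'n) \<Rightarrow> nat list \<Rightarrow> nat list \<Rightarrow> real^'n \<Rightarrow> real^'n" where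
  "jacobi_sum f v w = (\<lambda>x. \<Sum>\<sigma> | \<sigma> permutes {..<length v}.
     of_int (perm_coeff (length v) \<sigma>) *\<^sub>R comm_field f (permute_list \<sigma> v @ w) x)"

end

theory Submission
  imports Defs
begin

text \<open>
  The coefficients \<open>\<pi>\<^sub>\<ell>(\<sigma>)\<close> are those of the right-nested commutator
  \<open>[a\<^sub>1, [a\<^sub>2, \<dots>, a\<^sub>\<ell>]]\<close> in the free associative algebra.  The first identity then
  says that \<open>v \<mapsto> ad v\<close> turns commutators into commutators, by induction on \<open>v\<close>; only the
  linearity of Lie derivatives enters, never a Leibniz rule.  The second identity is the
  Dynkin--Specht--Wever theorem: splitting off the first letter \<open>a\<close> of \<open>av\<close> gives
  \<open>\<ell>\<close> copies of \<open>[a, v]\<close> by induction, and one more, \<open>- [v, a]\<close>, by the first identity.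
  Hence for the empty word the first identity is off by the factor \<open>\<ell>\<close>, and it fails for any
  nonzero commutator of length two, such as that of a constant field and the Euler field.
\<close>

section \<open>Alternating sums over words and their linearity\<close>

text \<open>The linear extension of \<open>F\<close>, a function on words, evaluated at the right-nested
  commutator of the letters of the argument.\<close>

fun bracket_sum :: "('a list \<Rightarrow> 'b::ab_group_add) \<Rightarrow> 'a list \<Rightarrow> 'b" where
  "bracket_sum F [] = 0"
| "bracket_sum F [a] = F [a]"
| "bracket_sum F (a # b # w) =
     bracket_sum (\<lambda>u. F (a # u)) (b # w) - bracket_sum (\<lambda>u. F (u @ [a])) (b # w)"

lemma bracket_sum_Cons:
  "w \<noteq> [] \<Longrightarrow> bracket_sum F (a # w) =
     bracket_sum (\<lambda>u. F (a # u)) w - bracket_sum (\<lambda>u. F (u @ [a])) w"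
  by (cases w) auto

text \<open>The recursion only moves letters, so \<open>F\<close> is evaluated at rearrangements of
  \<open>w\<close> alone. Length, letters and nonemptiness of \<open>w\<close> may therefore be
  assumed of every word that occurs.\<close>

lemma bracket_sum_cong:
  "(\<And>u. mset u = mset w \<Longrightarrow> F u = G u) \<Longrightarrow> bracket_sum F w = bracket_sum G w"
proof (induction w arbitrary: F G)
  case (Cons a w)
  show ?case
  proof (cases "w = []")
    case False
    then show ?thesis
      unfolding bracket_sum_Cons[OF False]
      by (intro arg_cong2[where f = minus] Cons.IH Cons.prems) auto
  qed (simp add: Cons.prems)
qed simp

lemma bracket_sum_diff:
  "bracket_sum (\<lambda>u. F u - G u) w = bracket_sum F w - bracket_sum G w"
  by (induction F w arbitrary: G rule: bracket_sum.induct) (simp_all add: algebra_simps)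

section \<open>From sums over permutations to nested commutators\<close>

lemma perm_coeff_cong:
  "(\<And>i. i < n \<Longrightarrow> \<sigma> i = \<tau> i) \<Longrightarrow> perm_coeff n \<sigma> = perm_coeff n \<tau>"
proof (induction n \<sigma> arbitrary: \<tau> rule: perm_coeff.induct)
  case (3 k \<sigma>)
  have "perm_coeff (Suc k) (\<lambda>i. \<sigma> (Suc i) - 1) = perm_coeff (Suc k) (\<lambda>i. \<tau> (Suc i) - 1)"
    if "\<sigma> 0 = 0" by (rule 3(1)[OF that]) (simp add: 3(3))
  moreover have "perm_coeff (Suc k) (\<lambda>i. \<sigma> i - 1) = perm_coeff (Suc k) (\<lambda>i. \<tau> i - 1)"
    if "\<sigma> 0 \<noteq> 0" "\<sigma> (Suc k) = 0" by (rule 3(2)[OF that]) (simp add: 3(3))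
  ultimately show ?case using 3(3) by simp
qed auto

text \<open>This map and the one in \<open>permutes_unshift_first\<close> are mutually inverse; they
  match permutations fixing 0 with permutations of one position less.\<close>

lemma permutes_shift_first:
  assumes "\<sigma> permutes {..<n}"
  shows "case_nat 0 (\<lambda>i. Suc (\<sigma> i)) permutes {..<Suc n}"
proof (rule inj_imp_permutes)
  show "inj_on (case_nat 0 (\<lambda>i. Suc (\<sigma> i))) {..<Suc n}"
    by (auto simp: inj_on_def inj_eq[OF permutes_inj[OF assms]] split: nat.splits)
next
  fix i assume "i \<in> {..<Suc n}"
  then show "case_nat 0 (\<lambda>i. Suc (\<sigma> i)) i \<in> {..<Suc n}"
    using permutes_in_image[OF assms] by (auto split: nat.splits)
next
  fix i assume "i \<notin> {..<Suc n}"
  then show "case_nat 0 (\<lambda>i. Suc (\<sigma> i)) i = i"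
    using permutes_not_in[OF assms] by (auto split: nat.splits)
qed simp

lemma permutes_unshift_first:
  assumes "\<tau> permutes {..<Suc n}" "\<tau> 0 = 0"
  shows "(\<lambda>i. \<tau> (Suc i) - 1) permutes {..<n}"
proof -
  have pos: "\<tau> (Suc i) \<noteq> 0" for i
    using inj_eq[OF permutes_inj[OF assms(1)], of "Suc i" 0] assms(2) by simp
  show ?thesis
  proof (rule inj_imp_permutes)
    show "inj_on (\<lambda>i. \<tau> (Suc i) - 1) {..<n}"
    proof (rule inj_onI)
      fix x y assume "\<tau> (Suc x) - 1 = \<tau> (Suc y) - 1"
      with pos[of x] pos[of y] have "\<tau> (Suc x) = \<tau> (Suc y)" by linarith
      then show "x = y" by (simp add: inj_eq[OF permutes_inj[OF assms(1)]])
    qed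
  next
    fix i assume "i \<in> {..<n}"
    then have "\<tau> (Suc i) < Suc n" using permutes_in_image[OF assms(1), of "Suc i"] by simp
    then show "\<tau> (Suc i) - 1 \<in> {..<n}" using pos[of i] by simp
  next
    fix i assume "i \<notin> {..<n}"
    then show "\<tau> (Suc i) - 1 = i" using permutes_not_in[OF assms(1), of "Suc i"] by simp
  qed simp
qed

text \<open>The counterpart for a letter moved to the last position \<open>n\<close>. Positions
  beyond \<open>n\<close> must be fixed explicitly, since \<open>Suc (\<sigma> i)\<close> would move
  them.\<close>

definition shift_last :: "nat \<Rightarrow> (nat \<Rightarrow> nat) \<Rightarrow> nat \<Rightarrow> nat" where
  "shift_last n \<sigma> i = (if i < n then Suc (\<sigma> i) else if i = n then 0 else i)"

definition unshift_last :: "nat \<Rightarrow> (nat \<Rightarrow> nat) \<Rightarrow> nat \<Rightarrow> nat" where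
  "unshift_last n \<tau> i = (if i < n then \<tau> i - 1 else i)"

lemma permutes_shift_last:
  assumes "\<sigma> permutes {..<n}"
  shows "shift_last n \<sigma> permutes {..<Suc n}"
proof (rule inj_imp_permutes)
  show "inj_on (shift_last n \<sigma>) {..<Suc n}"
    by (auto simp: inj_on_def inj_eq[OF permutes_inj[OF assms]] shift_last_def split: if_splits)
next
  fix i assume "i \<in> {..<Suc n}"
  then show "shift_last n \<sigma> i \<in> {..<Suc n}"
    using permutes_in_image[OF assms, of i] by (auto simp: shift_last_def)
qed (auto simp: shift_last_def)

lemma permutes_unshift_last:
  assumes "\<tau> permutes {..<Suc n}" "\<tau> n = 0"
  shows "unshift_last n \<tau> permutes {..<n}"
proof -
  have pos: "\<tau> i \<noteq> 0" if "i < n" for i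
    using that inj_eq[OF permutes_inj[OF assms(1)], of i n] assms(2) by simp
  show ?thesis
  proof (rule inj_imp_permutes)
    show "inj_on (unshift_last n \<tau>) {..<n}"
    proof (rule inj_onI)
      fix x y assume xy: "x \<in> {..<n}" "y \<in> {..<n}" "unshift_last n \<tau> x = unshift_last n \<tau> y"
      with pos[of x] pos[of y] have "\<tau> x = \<tau> y" by (simp add: unshift_last_def)
      then show "x = y" by (simp add: inj_eq[OF permutes_inj[OF assms(1)]])
    qed
  next
    fix i assume "i \<in> {..<n}"
    then show "unshift_last n \<tau> i \<in> {..<n}"
      using pos[of i] permutes_in_image[OF assms(1), of i] by (auto simp: unshift_last_def)
  qed (auto simp: unshift_last_def)
qed

lemma permute_list_shift_first:
  "permute_list (case_nat 0 (\<lambda>i. Suc (\<sigma> i))) (a # w) = a # permute_list \<sigma> w"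
  by (rule nth_equalityI) (auto simp: permute_list_def nth_Cons' simp del: upt_Suc split: nat.splits)

lemma permute_list_shift_last:
  "permute_list (shift_last (length w) \<sigma>) (a # w) = permute_list \<sigma> w @ [a]"
  by (simp add: permute_list_def shift_last_def)

text \<open>A permutation contributes only if the first letter \<open>a\<close> ends up first or
  last. Each of these classes corresponds to the permutations of the remaining letters, and the
  signs in \<open>perm_coeff\<close> give the two halves of the commutator with
  \<open>a\<close>.\<close>

lemma sum_perm_coeff:
  fixes F :: "'a list \<Rightarrow> 'b::real_vector"
  shows "(\<Sum>\<sigma> | \<sigma> permutes {..<length w}.
      of_int (perm_coeff (length w) \<sigma>) *\<^sub>R F (permute_list \<sigma> w)) = bracket_sum F w"
proof (induction w arbitrary: F)
  case (Cons a w)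
  show ?case
  proof (cases w)
    case Nil
    have "{..<Suc 0} = {0::nat}" by auto
    then show ?thesis using Nil by (simp add: permute_list_def)
  next
    case (Cons b w')
    define n where "n = length w"
    obtain k where n: "n = Suc k" using Cons by (simp add: n_def)
    let ?S = "{\<tau>. \<tau> permutes {..<Suc n}}"
    let ?A = "{\<tau>. \<tau> permutes {..<Suc n} \<and> \<tau> 0 = 0}"
    let ?C = "{\<tau>. \<tau> permutes {..<Suc n} \<and> \<tau> n = 0}"
    let ?t = "\<lambda>\<tau>. of_int (perm_coeff (Suc n) \<tau>) *\<^sub>R F (permute_list \<tau> (a # w))"
    have fin: "finite ?S" by (rule finite_permutations) simp
    \<comment> \<open>As \<open>n\<close> is positive, \<open>a\<close> cannot stand first and last
      at once; hence the single letter is a separate case.\<close>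
    have inj: "\<tau> 0 \<noteq> \<tau> n" if "\<tau> permutes {..<Suc n}" for \<tau> :: "nat \<Rightarrow> nat"
      using inj_eq[OF permutes_inj[OF that], of 0 n] n by simp
    have "sum ?t ?S = sum ?t (?A \<union> ?C)"
      by (rule sum.mono_neutral_right[OF fin]) (auto simp: n)
    also have "\<dots> = sum ?t ?A + sum ?t ?C"
    proof (rule sum.union_disjoint)
      show "finite ?A" "finite ?C" using fin by (auto intro: finite_subset)
      show "?A \<inter> ?C = {}" by (auto dest: inj)
    qed
    also have "sum ?t ?A = (\<Sum>\<sigma> | \<sigma> permutes {..<n}.
        of_int (perm_coeff n \<sigma>) *\<^sub>R F (a # permute_list \<sigma> w))"
    proof (rule sum.reindex_bij_witness[where i = "\<lambda>\<sigma>. case_nat 0 (\<lambda>i. Suc (\<sigma> i))"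
          and j = "\<lambda>\<tau> i. \<tau> (Suc i) - 1"])
      fix \<tau> assume "\<tau> \<in> ?A"
      then have t: "\<tau> permutes {..<Suc n}" "\<tau> 0 = 0" by simp_all
      have pos: "\<tau> (Suc i) \<noteq> 0" for i
        using inj_eq[OF permutes_inj[OF t(1)], of "Suc i" 0] t(2) by simp
      show *: "case_nat 0 (\<lambda>i. Suc (\<tau> (Suc i) - 1)) = \<tau>"
        using pos t(2) by (auto simp: fun_eq_iff split: nat.splits)
      show "(\<lambda>i. \<tau> (Suc i) - 1) \<in> {\<sigma>. \<sigma> permutes {..<n}}"
        using permutes_unshift_first[OF t] by simp
      have "perm_coeff (Suc n) \<tau> = perm_coeff n (\<lambda>i. \<tau> (Suc i) - 1)" using t by (simp add: n)
      moreover have "permute_list \<tau> (a # w) = a # permute_list (\<lambda>i. \<tau> (Suc i) - 1) w"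
        by (subst (1) *[symmetric]) (rule permute_list_shift_first)
      ultimately show "of_int (perm_coeff n (\<lambda>i. \<tau> (Suc i) - 1)) *\<^sub>R
          F (a # permute_list (\<lambda>i. \<tau> (Suc i) - 1) w) = ?t \<tau>" by simp
    qed (auto intro: permutes_shift_first)
    also have "sum ?t ?C = (\<Sum>\<sigma> | \<sigma> permutes {..<n}.
        - (of_int (perm_coeff n \<sigma>) *\<^sub>R F (permute_list \<sigma> w @ [a])))"
    proof (rule sum.reindex_bij_witness[where i = "shift_last n" and j = "unshift_last n"])
      fix \<tau> assume "\<tau> \<in> ?C"
      then have t: "\<tau> permutes {..<Suc n}" "\<tau> n = 0" by simp_all
      have pos: "\<tau> i \<noteq> 0" if "i < n" for i
        using that inj_eq[OF permutes_inj[OF t(1)], of i n] t(2) by simp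
      show *: "shift_last n (unshift_last n \<tau>) = \<tau>"
      proof
        fix i show "shift_last n (unshift_last n \<tau>) i = \<tau> i"
          using t(2) pos[of i] permutes_not_in[OF t(1), of i]
          by (auto simp: shift_last_def unshift_last_def)
      qed
      show "unshift_last n \<tau> \<in> {\<sigma>. \<sigma> permutes {..<n}}"
        using permutes_unshift_last[OF t] by simp
      \<comment> \<open>The recursive call uses a function that is no permutation of
        \<open>{..<n}\<close> (it sends \<open>n\<close> to 0), but it agrees with
        \<open>unshift_last n \<tau>\<close> below \<open>n\<close>.\<close>
      have "perm_coeff n (\<lambda>i. \<tau> i - 1) = perm_coeff n (unshift_last n \<tau>)"
        by (rule perm_coeff_cong) (simp add: unshift_last_def)
      then have "perm_coeff (Suc n) \<tau> = - perm_coeff n (unshift_last n \<tau>)"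
        using t pos[of 0] by (simp add: n)
      moreover have "permute_list \<tau> (a # w) = permute_list (unshift_last n \<tau>) w @ [a]"
        by (subst (1) *[symmetric]) (simp only: n_def permute_list_shift_last)
      ultimately show "- (of_int (perm_coeff n (unshift_last n \<tau>)) *\<^sub>R
          F (permute_list (unshift_last n \<tau>) w @ [a])) = ?t \<tau>" by simp
    next
      fix \<sigma> assume "\<sigma> \<in> {\<sigma>. \<sigma> permutes {..<n}}"
      then have s: "\<sigma> permutes {..<n}" by simp
      show "unshift_last n (shift_last n \<sigma>) = \<sigma>"
        using permutes_not_in[OF s] by (auto simp: fun_eq_iff shift_last_def unshift_last_def)
      show "shift_last n \<sigma> \<in> ?C"
        using permutes_shift_last[OF s] by (simp add: shift_last_def)
    qed
    finally show ?thesis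
      using Cons Cons.IH[of "\<lambda>u. F (a # u)"] Cons.IH[of "\<lambda>u. F (u @ [a])"]
      by (simp add: n_def sum_negf)
  qed
qed (simp add: permute_list_def)

section \<open>The two identities for words\<close>

text \<open>Induction on \<open>v\<close>. For one letter this is the recursion of
  \<open>bracket_sum\<close>; for \<open>a # v\<close> it is the Jacobi identity [[a,V],W] =
  [a,[V,W]] - [V,[a,W]], where V and W are the nested commutators of \<open>v\<close> and
  \<open>w\<close>.\<close>

lemma bracket_sum_swap:
  assumes "v \<noteq> []" "w \<noteq> []"
  shows "bracket_sum (\<lambda>u. bracket_sum (\<lambda>t. F (u @ t)) w) v -
         bracket_sum (\<lambda>t. bracket_sum (\<lambda>u. F (t @ u)) v) w =
         bracket_sum (\<lambda>u. bracket_sum F (u @ w)) v"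
  using assms
proof (induction v arbitrary: F w)
  case (Cons a v)
  show ?case
  proof (cases "v = []")
    case True
    then show ?thesis using Cons.prems by (simp add: bracket_sum_Cons)
  next
    case False
    have "bracket_sum (\<lambda>u. bracket_sum F (u @ w)) (a # v) =
        bracket_sum (\<lambda>u. bracket_sum F (a # u @ w)) v - bracket_sum (\<lambda>u. bracket_sum F (u @ a # w)) v"
      using False by (simp add: bracket_sum_Cons)
    also have "bracket_sum (\<lambda>u. bracket_sum F (a # u @ w)) v =
        bracket_sum (\<lambda>u. bracket_sum (\<lambda>t. F (a # t)) (u @ w)) v -
        bracket_sum (\<lambda>u. bracket_sum (\<lambda>t. F (t @ [a])) (u @ w)) v"
      using Cons.prems by (simp add: bracket_sum_Cons bracket_sum_diff)
    finally show ?thesis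
      \<comment> \<open>The induction hypothesis enters three times: for \<open>w\<close> with
        \<open>a\<close> put in front of or behind the argument of \<open>F\<close>, and for
        \<open>a # w\<close>.\<close>
      using False Cons.prems
      by (simp add: Cons.IH[symmetric] bracket_sum_Cons bracket_sum_diff)
  qed
qed simp

lemma bracket_sum_idem:
  fixes F :: "'a list \<Rightarrow> 'b::real_vector"
  shows "bracket_sum (bracket_sum F) v = real (length v) *\<^sub>R bracket_sum F v"
proof (induction v arbitrary: F)
  case (Cons a v)
  show ?case
  proof (cases "v = []")
    case False
    \<comment> \<open>Expanding at \<open>a\<close> requires \<open>u\<close> to be nonempty, which
      holds as \<open>u\<close> is a rearrangement of \<open>v\<close>.\<close>
    have "bracket_sum (\<lambda>u. bracket_sum F (a # u)) v =
        bracket_sum (\<lambda>u. bracket_sum (\<lambda>t. F (a # t)) u - bracket_sum (\<lambda>t. F (t @ [a])) u) v"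
      using False by (intro bracket_sum_cong bracket_sum_Cons) auto
    \<comment> \<open>The swap identity with the single letter \<open>a\<close> as second word:
      [V,a] = -[a,V]. This is the additional copy that raises the factor by one.\<close>
    moreover have "bracket_sum (\<lambda>u. bracket_sum F (u @ [a])) v = - bracket_sum F (a # v)"
      using False bracket_sum_swap[of v "[a]" F] by (simp add: bracket_sum_Cons)
    ultimately show ?thesis
      using False by (simp add: bracket_sum_Cons bracket_sum_diff Cons.IH algebra_simps)
  qed simp
qed simp

section \<open>Linearity of Lie derivatives\<close>

text \<open>A word acts through its last letter as coefficient and its earlier letters as
  derivatives; \<open>last\<close> is never taken of the empty word, where both sides are 0.\<close>

lemma comm_field_bracket_sum:
  "comm_field f w x = bracket_sum (\<lambda>u. iter_lie f (butlast u) (f (last u)) x) w"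
  unfolding comm_field_def by (rule sum_perm_coeff)

lemma comm_deriv_bracket_sum:
  "comm_deriv f w g x = bracket_sum (\<lambda>u. iter_lie f u g x) w"
  unfolding comm_deriv_def by (rule sum_perm_coeff)

lemma jacobi_sum_bracket_sum:
  "jacobi_sum f v w x = bracket_sum (\<lambda>u. comm_field f (u @ w) x) v"
  unfolding jacobi_sum_def by (rule sum_perm_coeff)

lemma tendsto_lie_deriv:
  assumes "lie_differentiable Z g"
  shows "(lie_quotient Z g x \<longlongrightarrow> lie_deriv Z g x) (at 0)"
  using assms tendsto_Lim[OF trivial_limit_at]
  unfolding lie_differentiable_def lie_deriv_def by metis

lemma lie_deriv_eqI:
  "(lie_quotient Z g x \<longlongrightarrow> l) (at 0) \<Longrightarrow> lie_deriv Z g x = l"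
  unfolding lie_deriv_def by (rule tendsto_Lim[OF trivial_limit_at])

text \<open>A \<open>Lim\<close> is meaningful only if the limit exists, so the rule is stated as
  convergence, which yields both differentiability and the value.\<close>

lemma tendsto_lie_quotient_diff:
  assumes "lie_differentiable Z g" "lie_differentiable Z h"
  shows "(lie_quotient Z (\<lambda>x. g x - h x) x \<longlongrightarrow> lie_deriv Z g x - lie_deriv Z h x) (at 0)"
proof -
  have "lie_quotient Z (\<lambda>x. g x - h x) x = (\<lambda>t. lie_quotient Z g x t - lie_quotient Z h x t)"
    by (simp add: lie_quotient_def fun_eq_iff algebra_simps)
  then show ?thesis using tendsto_diff[OF assms[THEN tendsto_lie_deriv]] by simp
qed

lemma iter_lie_diff:
  assumes "iter_lie_exists f js g" "iter_lie_exists f js h"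
  shows "iter_lie_exists f js (\<lambda>x. g x - h x)" (is ?E)
    and "iter_lie f js (\<lambda>x. g x - h x) = (\<lambda>x. iter_lie f js g x - iter_lie f js h x)" (is ?I)
proof -
  \<comment> \<open>Proved together: existence at the next letter concerns the iterated derivative
    of the difference, which \<open>?I\<close> rewrites.\<close>
  have "?E \<and> ?I" using assms
  proof (induction js)
    case (Cons j js)
    then have d: "lie_differentiable (f j) (iter_lie f js g)" "lie_differentiable (f j) (iter_lie f js h)"
      by simp_all
    have E: "iter_lie_exists f js (\<lambda>x. g x - h x)"
      and I: "iter_lie f js (\<lambda>x. g x - h x) = (\<lambda>x. iter_lie f js g x - iter_lie f js h x)"
      using Cons by simp_all
    show ?case
      unfolding iter_lie.simps iter_lie_exists.simps I lie_differentiable_def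
      using E tendsto_lie_quotient_diff[OF d] by (blast intro: lie_deriv_eqI)
  qed simp
  then show ?E ?I by simp_all
qed

lemma lie_const:
  shows "lie_differentiable Z (\<lambda>x. c)" and lie_deriv_const: "lie_deriv Z (\<lambda>x. c) = (\<lambda>x. 0)"
proof -
  have "(lie_quotient Z (\<lambda>x. c) x \<longlongrightarrow> 0) (at 0)" for x
    by (simp add: lie_quotient_def[abs_def])
  then show "lie_differentiable Z (\<lambda>x. c)" "lie_deriv Z (\<lambda>x. c) = (\<lambda>x. 0)"
    by (auto simp: lie_differentiable_def intro!: lie_deriv_eqI)
qed

lemma iter_lie_zero:
  "iter_lie_exists f js (\<lambda>x. 0 :: 'b::real_normed_vector) \<and>
   iter_lie f js (\<lambda>x. 0 :: 'b) = (\<lambda>x. 0)"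
proof (induction js)
  case (Cons j js)
  show ?case
    unfolding iter_lie.simps iter_lie_exists.simps conjunct2[OF Cons.IH] lie_deriv_const
    using conjunct1[OF Cons.IH] lie_const(1) by blast
qed simp

text \<open>A bracket sum is built from its terms by differences, so \<open>iter_lie_diff\<close>
  carries derivatives through it.\<close>

lemma iter_lie_bracket_sum:
  assumes "\<And>t. mset t = mset w \<Longrightarrow> iter_lie_exists f js (g t)"
  shows "iter_lie_exists f js (\<lambda>x. bracket_sum (\<lambda>t. g t x) w) \<and>
    iter_lie f js (\<lambda>x. bracket_sum (\<lambda>t. g t x) w) = (\<lambda>x. bracket_sum (\<lambda>t. iter_lie f js (g t) x) w)"
  using assms
proof (induction w arbitrary: g)
  case Nil
  then show ?case by (simp add: iter_lie_zero)
next
  case (Cons a w)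
  show ?case
  proof (cases "w = []")
    case True
    then show ?thesis using Cons.prems by simp
  next
    case False
    then show ?thesis
      using Cons.IH[of "\<lambda>t. g (a # t)"] Cons.IH[of "\<lambda>t. g (t @ [a])"] Cons.prems
      by (simp add: bracket_sum_Cons iter_lie_diff)
  qed
qed

lemma iter_lie_append: "iter_lie f (u @ v) g = iter_lie f u (iter_lie f v g)"
  by (induction u) simp_all

lemma iter_lie_exists_append:
  "iter_lie_exists f (u @ v) g \<longleftrightarrow> iter_lie_exists f v g \<and> iter_lie_exists f u (iter_lie f v g)"
  by (induction u) (auto simp: iter_lie_append)

section \<open>The commutator identity for vector fields\<close>

lemma regular_family_iter_lie_exists:
  assumes "regular_family s m f" "set js \<subseteq> {1..m}" "length js < s" "j \<in> {1..m}"
  shows "iter_lie_exists f js (f j)"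
proof -
  \<comment> \<open>Regularity speaks of exactly \<open>s - 1\<close> derivatives. Padding in front
    adds derivatives that act last, so existence for \<open>?ks\<close> includes existence for
    \<open>js\<close>.\<close>
  let ?ks = "replicate (s - 1 - length js) j @ js"
  have "set ?ks \<subseteq> {1..m}" using assms(2,4) by (simp add: set_replicate_conv_if)
  then have ks: "?ks \<in> lists {1..m}" by (simp only: lists_eq_set mem_Collect_eq)
  have len: "length ?ks = s - 1" using assms(3) by simp
  have "horiz_class m f (s - 1) (f j)" using assms(1,4) unfolding regular_family_def by blast
  then have "iter_lie_exists f ?ks (f j)" unfolding horiz_class_def using ks len by blast
  then show ?thesis by (simp add: iter_lie_exists_append)
qed

text \<open>Linearity moves the derivatives inside the sum for \<open>comm_field f w\<close>, where
  operators compose by concatenating words. Both terms of the bracket thus take the form required by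
  \<open>bracket_sum_swap\<close>.\<close>

lemma comm_deriv_comm_field:
  assumes "regular_family s m f" "set v \<subseteq> {1..m}" "set w \<subseteq> {1..m}"
    and "w \<noteq> []" "length v + length w \<le> s"
  shows "comm_deriv f v (comm_field f w) x =
    bracket_sum (\<lambda>u. bracket_sum (\<lambda>t. iter_lie f (butlast (u @ t)) (f (last (u @ t))) x) w) v"
proof -
  have "iter_lie f u (comm_field f w) x =
      bracket_sum (\<lambda>t. iter_lie f (butlast (u @ t)) (f (last (u @ t))) x) w"
    if u: "mset u = mset v" for u
  proof -
    have *: "iter_lie_exists f u (iter_lie f (butlast t) (f (last t)))" if t: "mset t = mset w" for t
    proof -
      have ne: "t \<noteq> []" using t assms(4) by auto
      have eq: "set u = set v" "set t = set w" "length u = length v" "length t = length w"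
        using mset_eq_setD[OF u] mset_eq_setD[OF t] mset_eq_length[OF u] mset_eq_length[OF t]
        by simp_all
      have "set (u @ butlast t) \<subseteq> {1..m}" using eq assms(2,3) by (auto dest: in_set_butlastD)
      \<comment> \<open>One letter of \<open>t\<close> is the coefficient, so at most
        \<open>s - 1\<close> derivatives are taken.\<close>
      moreover have "length (u @ butlast t) < s"
        using eq assms(4,5) ne by (cases w) auto
      moreover have "last t \<in> {1..m}" using eq assms(3) ne last_in_set by blast
      ultimately have "iter_lie_exists f (u @ butlast t) (f (last t))"
        using regular_family_iter_lie_exists[OF assms(1)] by blast
      then show ?thesis by (simp add: iter_lie_exists_append)
    qed
    have "iter_lie f u (comm_field f w) x =
        bracket_sum (\<lambda>t. iter_lie f u (iter_lie f (butlast t) (f (last t))) x) w"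
      using iter_lie_bracket_sum[of w f u "\<lambda>t. iter_lie f (butlast t) (f (last t))"] *
      by (simp add: comm_field_bracket_sum[abs_def])
    also have "\<dots> = bracket_sum (\<lambda>t. iter_lie f (butlast (u @ t)) (f (last (u @ t))) x) w"
      using assms(4) by (intro bracket_sum_cong) (auto simp: iter_lie_append butlast_append)
    finally show ?thesis .
  qed
  then show ?thesis
    unfolding comm_deriv_bracket_sum by (intro bracket_sum_cong) blast
qed

lemma bracket_field_eq_jacobi_sum:
  assumes "regular_family s m f" "set v \<subseteq> {1..m}" "set w \<subseteq> {1..m}"
    and "v \<noteq> []" "w \<noteq> []" "length v + length w \<le> s"
  shows "bracket_field f v w = jacobi_sum f v w"
proof
  fix x
  show "bracket_field f v w x = jacobi_sum f v w x"
    using bracket_sum_swap[OF assms(4,5)] assms(6)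
      comm_deriv_comm_field[OF assms(1-3,5,6)] comm_deriv_comm_field[OF assms(1,3,2,4)]
    by (simp add: bracket_field_def jacobi_sum_bracket_sum comm_field_bracket_sum add.commute)
qed

lemma jacobi_sum_Nil: "jacobi_sum f v [] x = real (length v) *\<^sub>R comm_field f v x"
  by (simp add: jacobi_sum_bracket_sum comm_field_bracket_sum bracket_sum_idem)

subsection \<open>A family for which the first identity fails for the empty word\<close>

text \<open>Subtracting the expected solution leaves a function with zero derivative. The uniqueness
  so obtained evaluates the \<open>THE\<close> in \<open>flow\<close>.\<close>

lemma is_flow_const: "is_flow (\<lambda>z. k) t x y \<longleftrightarrow> y = x + t *\<^sub>R k"
proof
  assume "is_flow (\<lambda>z. k) t x y"
  then obtain u where u: "u 0 = x" "u t = y"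
    "\<And>\<tau>. \<tau> \<in> closed_segment 0 t \<Longrightarrow> (u has_vector_derivative k) (at \<tau> within closed_segment 0 t)"
    unfolding is_flow_def by blast
  have d: "((\<lambda>\<tau>. u \<tau> - \<tau> *\<^sub>R k) has_vector_derivative 0) (at \<tau> within closed_segment 0 t)"
    if "\<tau> \<in> closed_segment 0 t" for \<tau>
    using u(3)[OF that] by (auto intro!: derivative_eq_intros)
  obtain c where c: "\<forall>\<tau>\<in>closed_segment 0 t. u \<tau> - \<tau> *\<^sub>R k = c"
    using has_vector_derivative_zero_constant[OF convex_closed_segment d] by metis
  from bspec[OF c, of 0] bspec[OF c, of t] u(1,2) show "y = x + t *\<^sub>R k" by (auto simp: algebra_simps)
next
  assume "y = x + t *\<^sub>R k"
  then show "is_flow (\<lambda>z. k) t x y"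
    unfolding is_flow_def
    by (intro exI[of _ "\<lambda>\<tau>. x + \<tau> *\<^sub>R k"]) (auto intro!: derivative_eq_intros)
qed

lemma is_flow_linear: "is_flow (\<lambda>z. r *\<^sub>R z) t x y \<longleftrightarrow> y = exp (t * r) *\<^sub>R x"
proof
  assume "is_flow (\<lambda>z. r *\<^sub>R z) t x y"
  then obtain u where u: "u 0 = x" "u t = y"
    "\<And>\<tau>. \<tau> \<in> closed_segment 0 t \<Longrightarrow>
       (u has_vector_derivative r *\<^sub>R u \<tau>) (at \<tau> within closed_segment 0 t)"
    unfolding is_flow_def by blast
  \<comment> \<open>The integrating factor. A general \<open>r\<close> is kept because the control
    distance uses rescaled fields.\<close>
  have d: "((\<lambda>\<tau>. exp (- (\<tau> * r)) *\<^sub>R u \<tau>) has_vector_derivative 0) (at \<tau> within closed_segment 0 t)"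
    if "\<tau> \<in> closed_segment 0 t" for \<tau>
  proof -
    have "((\<lambda>\<tau>. exp (- (\<tau> * r))) has_field_derivative - r * exp (- (\<tau> * r)))
        (at \<tau> within closed_segment 0 t)"
      by (auto intro!: derivative_eq_intros)
    from has_vector_derivative_scaleR[OF this u(3)[OF that]] show ?thesis
      by (simp add: algebra_simps)
  qed
  obtain c where c: "\<forall>\<tau>\<in>closed_segment 0 t. exp (- (\<tau> * r)) *\<^sub>R u \<tau> = c"
    using has_vector_derivative_zero_constant[OF convex_closed_segment d] by metis
  from bspec[OF c, of 0] bspec[OF c, of t] u(1,2) have "exp (- (t * r)) *\<^sub>R y = x" by auto
  then have "exp (t * r) *\<^sub>R x = (exp (t * r) * exp (- (t * r))) *\<^sub>R y" by (metis scaleR_scaleR)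
  then show "y = exp (t * r) *\<^sub>R x" by (simp add: exp_minus)
next
  assume y: "y = exp (t * r) *\<^sub>R x"
  have "((\<lambda>\<tau>. exp (\<tau> * r) *\<^sub>R x) has_vector_derivative r *\<^sub>R exp (\<tau> * r) *\<^sub>R x)
      (at \<tau> within closed_segment 0 t)" for \<tau>
  proof -
    have "((\<lambda>\<tau>. exp (\<tau> * r)) has_field_derivative r * exp (\<tau> * r)) (at \<tau> within closed_segment 0 t)"
      by (auto intro!: derivative_eq_intros)
    from has_vector_derivative_scaleR[OF this has_vector_derivative_const] show ?thesis
      by simp
  qed
  then show "is_flow (\<lambda>z. r *\<^sub>R z) t x y"
    unfolding is_flow_def using y by (intro exI[of _ "\<lambda>\<tau>. exp (\<tau> * r) *\<^sub>R x"]) auto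
qed

lemma flow_const: "flow (\<lambda>z. k) t x = x + t *\<^sub>R k"
  by (simp add: flow_def is_flow_const)

lemma flow_id: "flow (\<lambda>z. z) t x = exp t *\<^sub>R x"
  by (simp add: flow_def is_flow_linear[of 1, simplified])

lemma lie_const_id:
  shows "lie_differentiable (\<lambda>z. k) (\<lambda>x. x)" and "lie_deriv (\<lambda>z. k) (\<lambda>x. x) = (\<lambda>x. k)"
proof -
  have "(lie_quotient (\<lambda>z. k) (\<lambda>x. x) x \<longlongrightarrow> k) (at 0)" for x
    \<comment> \<open>The quotient equals \<open>k\<close> for every \<open>t\<close> other than 0;
      the filter leaves out 0, where division by zero gives 0.\<close>
    by (rule tendsto_eventually) (simp add: lie_quotient_def flow_const eventually_at_filter)
  then show "lie_differentiable (\<lambda>z. k) (\<lambda>x. x)" "lie_deriv (\<lambda>z. k) (\<lambda>x. x) = (\<lambda>x. k)"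
    by (auto simp: lie_differentiable_def intro!: lie_deriv_eqI)
qed

lemma lie_id_id:
  shows "lie_differentiable (\<lambda>z. z) (\<lambda>x::real^'n. x)"
    and "lie_deriv (\<lambda>z. z) (\<lambda>x::real^'n. x) = (\<lambda>x. x)"
proof -
  have "((\<lambda>t::real. (exp t - 1) / t) \<longlongrightarrow> 1) (at 0)"
    using DERIV_exp[of 0] by (simp add: has_field_derivative_iff)
  then have "((\<lambda>t. ((exp t - 1) / t) *\<^sub>R x) \<longlongrightarrow> 1 *\<^sub>R x) (at 0)" for x :: "real^'n"
    by (intro tendsto_intros)
  moreover have "lie_quotient (\<lambda>z. z) (\<lambda>x. x) x = (\<lambda>t. ((exp t - 1) / t) *\<^sub>R x)" for x :: "real^'n"
    by (simp add: lie_quotient_def flow_id fun_eq_iff divide_inverse mult.commute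
        scaleR_left_diff_distrib flip: scaleR_scaleR)
  ultimately have "(lie_quotient (\<lambda>z. z) (\<lambda>x. x) x \<longlongrightarrow> x) (at 0)" for x :: "real^'n"
    by (simp only: scaleR_one)
  then show "lie_differentiable (\<lambda>z. z) (\<lambda>x::real^'n. x)"
    "lie_deriv (\<lambda>z. z) (\<lambda>x::real^'n. x) = (\<lambda>x. x)"
    by (auto simp: lie_differentiable_def intro!: lie_deriv_eqI)
qed

section \<open>A constant field and the Euler field\<close>

definition affine_family :: "real^'n \<Rightarrow> nat \<Rightarrow> real^'n \<Rightarrow> real^'n" where
  "affine_family k j = (if j = 1 then (\<lambda>x. k) else (\<lambda>x. x))"

lemma abs_exp_minus_one_le: "\<bar>exp s - 1\<bar> \<le> exp \<bar>s\<bar> - (1::real)"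
proof (cases "s \<ge> 0")
  case False
  have "1 - s \<le> exp (- s)" "1 + s \<le> exp s"
    using exp_ge_add_one_self[of "-s"] exp_ge_add_one_self[of s] by auto
  moreover have "\<bar>exp s - 1\<bar> = 1 - exp s" "\<bar>s\<bar> = - s" using False by simp_all
  ultimately show ?thesis by linarith
qed simp

text \<open>Along both kinds of steps the quantity \<open>norm x + 1\<close> grows at most by the factor
  \<open>exp (r * \<bar>t\<bar>)\<close>, which makes the bound stable under composition.\<close>

lemma flow_comp_affine_dist:
  assumes "norm k \<le> 1" "r > 0" "flow_comp ps x y"
    and "\<forall>(t, Z)\<in>set ps. Z \<in> {\<lambda>z. r *\<^sub>R affine_family k j z | j. j \<in> {1..m}}"
  shows "norm (y - x) \<le> (exp (r * (\<Sum>(t, Z)\<leftarrow>ps. \<bar>t\<bar>)) - 1) * (norm x + 1)"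
  using assms(3,4)
proof (induction ps arbitrary: y)
  case (Cons p ps)
  obtain t Z where p: "p = (t, Z)" by fastforce
  from Cons.prems(1) obtain z where z: "flow_comp ps x z" "is_flow Z t z y" by (auto simp: p)
  define S where "S = (\<Sum>(t, Z)\<leftarrow>ps. \<bar>t\<bar>)"
  have IH: "norm (z - x) \<le> (exp (r * S) - 1) * (norm x + 1)"
    unfolding S_def using Cons z by auto
  have "Z = (\<lambda>z. r *\<^sub>R k) \<or> Z = (\<lambda>z. r *\<^sub>R z)"
    using Cons.prems(2) by (auto simp: p affine_family_def)
  then have step: "norm (y - z) \<le> (exp (r * \<bar>t\<bar>) - 1) * (norm z + 1)"
  proof
    assume "Z = (\<lambda>z. r *\<^sub>R k)"
    then have "norm (y - z) = r * \<bar>t\<bar> * norm k"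
      using z(2) assms(2) by (simp add: is_flow_const abs_mult)
    also have "\<dots> \<le> r * \<bar>t\<bar>" using assms(1,2) by (simp add: mult_left_le)
    also have "\<dots> \<le> exp (r * \<bar>t\<bar>) - 1" using exp_ge_add_one_self[of "r * \<bar>t\<bar>"] by linarith
    also have "\<dots> \<le> (exp (r * \<bar>t\<bar>) - 1) * (norm z + 1)"
      using assms(2) mult_left_mono[of 1 "norm z + 1" "exp (r * \<bar>t\<bar>) - 1"] by simp
    finally show ?thesis .
  next
    assume "Z = (\<lambda>z. r *\<^sub>R z)"
    then have "y - z = (exp (t * r) - 1) *\<^sub>R z"
      using z(2) by (simp add: is_flow_linear algebra_simps)
    then have "norm (y - z) = \<bar>exp (t * r) - 1\<bar> * norm z" by simp
    also have "\<dots> \<le> (exp \<bar>t * r\<bar> - 1) * (norm z + 1)"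
      by (intro mult_mono abs_exp_minus_one_le) auto
    finally show ?thesis using assms(2) by (simp add: abs_mult mult.commute)
  qed
  have "norm z + 1 \<le> norm x + norm (z - x) + 1" using norm_triangle_sub[of z x] by simp
  also have "\<dots> \<le> exp (r * S) * (norm x + 1)" using IH by (simp add: algebra_simps)
  finally have "(exp (r * \<bar>t\<bar>) - 1) * (norm z + 1) \<le> (exp (r * \<bar>t\<bar>) - 1) * (exp (r * S) * (norm x + 1))"
    using assms(2) by (intro mult_left_mono) auto
  moreover have "norm (y - x) \<le> norm (y - z) + norm (z - x)"
    using norm_triangle_ineq[of "y - z" "z - x"] by simp
  \<comment> \<open>The bounds telescope: (exp a - 1) exp b + (exp b - 1) = exp (a + b) - 1.\<close>
  ultimately have "norm (y - x) \<le>
      (exp (r * \<bar>t\<bar>) - 1) * (exp (r * S) * (norm x + 1)) + (exp (r * S) - 1) * (norm x + 1)"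
    using step IH by linarith
  also have "\<dots> = (exp (r * (\<bar>t\<bar> + S)) - 1) * (norm x + 1)"
    by (simp add: algebra_simps exp_add)
  finally show ?case by (simp add: p S_def)
qed simp

text \<open>For \<open>r \<le> 1\<close> the path estimate applies with exp r - 1 \<le> 2 r; for
  larger \<open>r\<close> the diameter bound 2 M suffices. The constant \<open>2 * (M + 1)\<close>
  serves both cases.\<close>

lemma ctrl_dist_affine_ge:
  assumes "norm k \<le> 1" "norm x \<le> M" "norm y \<le> M"
  shows "ennreal (norm (x - y)) \<le> ennreal (2 * (M + 1)) * ctrl_dist m (affine_family k) x y"
proof -
  have M: "M \<ge> 0" using assms(2) norm_ge_zero[of x] by linarith
  have "ennreal (norm (x - y) / (2 * (M + 1))) \<le> ctrl_dist m (affine_family k) x y"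
    unfolding ctrl_dist_def
  proof (rule Inf_greatest, clarify)
    fix r :: real and ps
    assume r: "r > 0" and ps: "(\<Sum>(t, Z)\<leftarrow>ps. \<bar>t\<bar>) \<le> 1"
      "\<forall>(t, Z)\<in>set ps. Z \<in> {\<lambda>z. r *\<^sub>R affine_family k j z |j. j \<in> {1..m}}"
      "flow_comp ps x y"
    have "norm (x - y) \<le> 2 * (M + 1) * r"
    proof (cases "r \<le> 1")
      case True
      have "norm (x - y) \<le> (exp (r * (\<Sum>(t, Z)\<leftarrow>ps. \<bar>t\<bar>)) - 1) * (norm x + 1)"
        using flow_comp_affine_dist[OF assms(1) r ps(3,2)] by (simp add: norm_minus_commute)
      also have "\<dots> \<le> (exp r - 1) * (M + 1)"
        using r ps(1) assms(2) by (intro mult_mono) (auto simp: mult_left_le)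
      also have "\<dots> \<le> (2 * r) * (M + 1)"
      proof (intro mult_right_mono)
        have "exp r \<le> 1 + r + r\<^sup>2" using exp_bound[of r] r True by simp
        moreover have "r\<^sup>2 \<le> r" using r True by (simp add: power2_eq_square mult_left_le)
        ultimately show "exp r - 1 \<le> 2 * r" by simp
      qed (use M in simp)
      finally show ?thesis by (simp add: algebra_simps)
    next
      case False
      have "norm (x - y) \<le> 2 * (M + 1) * 1"
        using norm_triangle_ineq4[of x y] assms(2,3) by (simp add: algebra_simps)
      also have "\<dots> \<le> 2 * (M + 1) * r" using False M by (intro mult_left_mono) auto
      finally show ?thesis .
    qed
    then show "ennreal (norm (x - y) / (2 * (M + 1))) \<le> ennreal r"
      using M by (intro ennreal_leI) (simp add: divide_le_eq mult.commute)
  qed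
  then have le: "ennreal (2 * (M + 1)) * ennreal (norm (x - y) / (2 * (M + 1))) \<le>
      ennreal (2 * (M + 1)) * ctrl_dist m (affine_family k) x y"
    by (rule mult_left_mono) simp
  have "ennreal (2 * (M + 1)) * ennreal (norm (x - y) / (2 * (M + 1))) =
      ennreal (2 * (M + 1) * (norm (x - y) / (2 * (M + 1))))"
    using M by (intro ennreal_mult[symmetric]) auto
  also have "2 * (M + 1) * (norm (x - y) / (2 * (M + 1))) = norm (x - y)" using M by simp
  finally show ?thesis using le by simp
qed

lemma ctrl_lipschitz_on_affine:
  assumes "norm k \<le> 1" "bounded A" "\<And>x y. norm (g x - g y) \<le> norm (x - y)"
  shows "ctrl_lipschitz_on m (affine_family k) A g"
proof -
  obtain M where M: "\<And>x. x \<in> A \<Longrightarrow> norm x \<le> M" using assms(2) by (auto simp: bounded_iff)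
  have "ennreal (norm (g x - g y)) / ctrl_dist m (affine_family k) x y \<le> ennreal (2 * (M + 1))"
    if "x \<in> A" "y \<in> A" "x \<noteq> y" for x y
  \<comment> \<open>The lower bound on the control distance makes the divisor positive for distinct
    points and also bounds the quotient.\<close>
  proof (rule divide_le_posI_ennreal)
    have le: "ennreal (norm (x - y)) \<le> ennreal (2 * (M + 1)) * ctrl_dist m (affine_family k) x y"
      using that M by (intro ctrl_dist_affine_ge assms(1)) auto
    moreover have "ennreal (norm (x - y)) > 0" using that by simp
    ultimately show "ctrl_dist m (affine_family k) x y > 0"
      by (metis gr_zeroI mult_zero_right not_le)
    show "ennreal (norm (g x - g y)) \<le> ctrl_dist m (affine_family k) x y * ennreal (2 * (M + 1))"
      using order_trans[OF ennreal_leI[OF assms(3)] le] by (simp add: mult.commute)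
  qed
  then have "(SUP (x, y)\<in>{(x, y). x \<in> A \<and> y \<in> A \<and> x \<noteq> y}.
      ennreal (norm (g x - g y)) / ctrl_dist m (affine_family k) x y) \<le> ennreal (2 * (M + 1))"
    by (intro SUP_least) auto
  also have "\<dots> < \<infinity>" by simp
  finally show ?thesis unfolding ctrl_lipschitz_on_def .
qed

lemma lie_affine_family:
  shows "lie_differentiable (affine_family k i) (affine_family k j)"
    and "lie_deriv (affine_family k i) (affine_family k j) =
      (if j = 1 then (\<lambda>x. 0) else affine_family k i)"
  unfolding affine_family_def
  by (cases "j = 1"; cases "i = 1"; simp only: if_True if_False lie_const lie_const_id lie_id_id)+

text \<open>For \<open>s = 2\<close> one derivative has to be controlled. It is zero or again a
  member of the family, hence 1-Lipschitz in the Euclidean norm.\<close>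

lemma regular_family_affine:
  assumes "norm k \<le> 1"
  shows "regular_family 2 m (affine_family k)"
  unfolding regular_family_def
proof (intro ballI conjI)
  fix j
  show "C1 (affine_family k j)"
  proof (cases "j = 1")
    case True
    then show ?thesis
      unfolding C1_def affine_family_def
      by (intro exI[of _ "\<lambda>x. 0"]) (auto simp: zero_blinfun.rep_eq)
  next
    case False
    then show ?thesis
      unfolding C1_def affine_family_def
      by (intro exI[of _ "\<lambda>x. id_blinfun"]) (auto simp: id_blinfun.rep_eq id_def)
  qed
  show "horiz_class m (affine_family k) (2 - 1) (affine_family k j)"
    unfolding horiz_class_def
  proof (intro ballI impI)
    fix js :: "nat list" assume "length js = 2 - 1"
    then obtain i where js: "js = [i]" by (cases js) auto
    show "iter_lie_exists (affine_family k) js (affine_family k j) \<and>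
      (\<forall>A. bounded A \<longrightarrow>
        ctrl_lipschitz_on m (affine_family k) A (iter_lie (affine_family k) js (affine_family k j)))"
    proof (intro conjI allI impI)
      show "iter_lie_exists (affine_family k) js (affine_family k j)"
        by (simp add: js lie_affine_family)
      fix A :: "(real^'a) set" assume A: "bounded A"
      show "ctrl_lipschitz_on m (affine_family k) A (iter_lie (affine_family k) js (affine_family k j))"
        by (rule ctrl_lipschitz_on_affine[OF assms A])
          (simp add: js lie_affine_family, simp add: affine_family_def)
    qed
  qed
qed

lemma comm_field_ne_jacobi_sum_Nil:
  assumes "k \<noteq> 0"
  shows "comm_field (affine_family k) [1, 2] \<noteq> jacobi_sum (affine_family k) [1, 2] []"
proof
  assume "comm_field (affine_family k) [1, 2] = jacobi_sum (affine_family k) [1, 2] []"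
  then have "comm_field (affine_family k) [1, 2] 0 =
      real (length [1::nat, 2]) *\<^sub>R comm_field (affine_family k) [1, 2] 0"
    unfolding jacobi_sum_Nil[symmetric] by (rule fun_cong)
  \<comment> \<open>The derivative of the Euler field along the constant field is \<open>k\<close>,
    and that of the constant field along the Euler field is 0.\<close>
  moreover have "comm_field (affine_family k) [1, 2] 0 = k"
    by (simp add: comm_field_bracket_sum lie_affine_family) (simp add: affine_family_def)
  ultimately have "k = 2 *\<^sub>R k" by simp
  then show False using assms by (simp add: scaleR_2)
qed

theorem proposition3p3:
  "(\<forall>s m (f :: nat \<Rightarrow> real^'n \<Rightarrow> real^'n). s \<ge> 1 \<and> regular_family s m f \<longrightarrow>
      (\<forall>v\<in>lists {1..m}. \<forall>w\<in>lists {1..m}.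
         length v \<ge> 1 \<and> length w \<ge> 1 \<and> length v + length w \<le> s \<longrightarrow>
         bracket_field f v w = jacobi_sum f v w)) \<and>
   \<not> (\<forall>s m (f :: nat \<Rightarrow> real^'n \<Rightarrow> real^'n). s \<ge> 1 \<and> regular_family s m f \<longrightarrow>
      (\<forall>v\<in>lists {1..m}. length v \<ge> 1 \<and> length v \<le> s \<longrightarrow>
         comm_field f v = jacobi_sum f v [])) \<and>
   (\<forall>s m (f :: nat \<Rightarrow> real^'n \<Rightarrow> real^'n). s \<ge> 1 \<and> regular_family s m f \<longrightarrow>
      (\<forall>v\<in>lists {1..m}. length v \<ge> 1 \<and> length v \<le> s \<longrightarrow>
         comm_field f v = (\<lambda>x. (1 / real (length v)) *\<^sub>R jacobi_sum f v [] x)))"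


proof (intro conjI)
  show "\<forall>s m (f :: nat \<Rightarrow> real^'n \<Rightarrow> real^'n). s \<ge> 1 \<and> regular_family s m f \<longrightarrow>
      (\<forall>v\<in>lists {1..m}. \<forall>w\<in>lists {1..m}.
         length v \<ge> 1 \<and> length w \<ge> 1 \<and> length v + length w \<le> s \<longrightarrow>
         bracket_field f v w = jacobi_sum f v w)"
    by (intro allI impI ballI bracket_field_eq_jacobi_sum) (auto simp: lists_eq_set)
  show "\<forall>s m (f :: nat \<Rightarrow> real^'n \<Rightarrow> real^'n). s \<ge> 1 \<and> regular_family s m f \<longrightarrow>
      (\<forall>v\<in>lists {1..m}. length v \<ge> 1 \<and> length v \<le> s \<longrightarrow>
         comm_field f v = (\<lambda>x. (1 / real (length v)) *\<^sub>R jacobi_sum f v [] x))"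
    by (auto simp: jacobi_sum_Nil fun_eq_iff)
  \<comment> \<open>A unit vector is both nonzero, for the failure, and of norm at most 1, for the
    regularity.\<close>
  obtain k :: "real^'n" where k: "norm k = 1" using vector_choose_size[of 1] by auto
  show "\<not> (\<forall>s m (f :: nat \<Rightarrow> real^'n \<Rightarrow> real^'n). s \<ge> 1 \<and> regular_family s m f \<longrightarrow>
      (\<forall>v\<in>lists {1..m}. length v \<ge> 1 \<and> length v \<le> s \<longrightarrow>
         comm_field f v = jacobi_sum f v []))"
  proof
    assume H: "\<forall>s m (f :: nat \<Rightarrow> real^'n \<Rightarrow> real^'n). s \<ge> 1 \<and> regular_family s m f \<longrightarrow>
      (\<forall>v\<in>lists {1..m}. length v \<ge> 1 \<and> length v \<le> s \<longrightarrow>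
         comm_field f v = jacobi_sum f v [])"
    have "comm_field (affine_family k) [1, 2] = jacobi_sum (affine_family k) [1, 2] []"
      using H[rule_format, of 2 2 "affine_family k" "[1, 2]"] regular_family_affine[of k 2] k
      by simp
    then show False using comm_field_ne_jacobi_sum_Nil[of k] k by fastforce
  qed
qed

end
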